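(* The class of all countable $C_4$-free graphs (i.e., all graphs with universe $\mathbb{N}$ admitting no injective homomorphism from the $4$-cycle $C_4$) admits no generic element.
   Context: Graphs are $\mathcal{L}$-structures for a single binary (symmetric, irreflexive) edge relation. The class $\mathcal{C}$ of countable $C_4$-free graphs is the class of graphs on universe $\mathbb{N}$ with no injective homomorphism $C_4\to N$; it is a Polish space whose basic open sets are $\mathcal{O}_A=\{N\in\mathcal{C}: \text{the restriction of } N \text{ to } \mathrm{dom}(A) \text{ equals } A\}$, with $A$ ranging over finite $C_4$-free graphs with $\mathrm{dom}(A)\subseteq\mathbb{N}$. An element $G\in\mathcal{C}$ is generic if $\{N\in\mathcal{C}: N\cong G\}$ is comeager in $\mathcal{C}$. *)

theory Defs
  imports "HOL-Analysis.Analysis"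
begin

text \<open>A graph is a vertex set \<open>V\<close> together with an edge relation \<open>E\<close>, every edge being
  represented by both of its orientations. Requiring \<open>E \<subseteq> V \<times> V\<close> makes equality of
  structures literal equality of \<open>V\<close> and \<open>E\<close>.\<close>

definition is_graph :: "'a set \<Rightarrow> ('a \<times> 'a) set \<Rightarrow> bool" where
  "is_graph V E \<longleftrightarrow> E \<subseteq> V \<times> V \<and> sym E \<and> irrefl E"

definition graph_hom :: "'a set \<Rightarrow> ('a \<times> 'a) set \<Rightarrow> 'b set \<Rightarrow> ('b \<times> 'b) set \<Rightarrow> ('a \<Rightarrow> 'b) \<Rightarrow> bool" where
  "graph_hom V E W F f \<longleftrightarrow> f ` V \<subseteq> W \<and> (\<forall>x\<in>V. \<forall>y\<in>V. (x, y) \<in> E \<longrightarrow> (f x, f y) \<in> F)"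

definition graph_isomorphic :: "'a set \<Rightarrow> ('a \<times> 'a) set \<Rightarrow> 'b set \<Rightarrow> ('b \<times> 'b) set \<Rightarrow> bool" where
  "graph_isomorphic V E W F \<longleftrightarrow>
     (\<exists>f. bij_betw f V W \<and> (\<forall>x\<in>V. \<forall>y\<in>V. (x, y) \<in> E \<longleftrightarrow> (f x, f y) \<in> F))"

definition restrict_graph :: "('a \<times> 'a) set \<Rightarrow> 'a set \<Rightarrow> ('a \<times> 'a) set" where
  "restrict_graph E V = E \<inter> V \<times> V"

definition C4_verts :: "nat set" where
  "C4_verts = {0..<4}"

definition C4_edges :: "(nat \<times> nat) set" where
  "C4_edges = {(i, j). i < 4 \<and> j < 4 \<and> (j = (i + 1) mod 4 \<or> i = (j + 1) mod 4)}"

definition C4_free :: "'a set \<Rightarrow> ('a \<times> 'a) set \<Rightarrow> bool" where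
  "C4_free V E \<longleftrightarrow> \<not> (\<exists>f. graph_hom C4_verts C4_edges V E f \<and> inj_on f C4_verts)"

text \<open>Graphs on the universe of all natural numbers are represented by their edge relation.\<close>

definition C4_free_class :: "(nat \<times> nat) set set" where
  "C4_free_class = {N. is_graph UNIV N \<and> C4_free UNIV N}"

definition basic_open :: "nat set \<Rightarrow> (nat \<times> nat) set \<Rightarrow> (nat \<times> nat) set set" where
  "basic_open V A = {N \<in> C4_free_class. restrict_graph N V = A}"

definition C4_free_topology :: "(nat \<times> nat) set topology" where
  "C4_free_topology = topology_generated_by
     {basic_open V A | V A. finite V \<and> is_graph V A \<and> C4_free V A}"

definition nowhere_dense_in :: "'a topology \<Rightarrow> 'a set \<Rightarrow> bool" where
  "nowhere_dense_in X S \<longleftrightarrow> S \<subseteq> topspace X \<and> X interior_of (X closure_of S) = {}"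

definition meager_in :: "'a topology \<Rightarrow> 'a set \<Rightarrow> bool" where
  "meager_in X S \<longleftrightarrow> (\<exists>\<F>. countable \<F> \<and> (\<forall>T\<in>\<F>. nowhere_dense_in X T) \<and> S = \<Union>\<F>)"

definition comeager_in :: "'a topology \<Rightarrow> 'a set \<Rightarrow> bool" where
  "comeager_in X S \<longleftrightarrow> S \<subseteq> topspace X \<and> meager_in X (topspace X - S)"

definition generic :: "(nat \<times> nat) set \<Rightarrow> bool" where
  "generic G \<longleftrightarrow> G \<in> C4_free_class \<and>
     comeager_in C4_free_topology {N \<in> C4_free_class. graph_isomorphic UNIV N UNIV G}"

lemma restrict_graph_C4_free:
  assumes "N \<in> C4_free_class"
  shows "is_graph V (restrict_graph N V)" "C4_free V (restrict_graph N V)"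
proof -
  have "sym N" "irrefl N" "C4_free UNIV N"
    using assms by (auto simp: C4_free_class_def is_graph_def)
  then show "is_graph V (restrict_graph N V)"
    unfolding is_graph_def restrict_graph_def sym_def irrefl_def by blast
  have "graph_hom C4_verts C4_edges UNIV N f"
    if "graph_hom C4_verts C4_edges V (restrict_graph N V) f" for f
    using that unfolding graph_hom_def restrict_graph_def by blast
  then show "C4_free V (restrict_graph N V)"
    using \<open>C4_free UNIV N\<close> unfolding C4_free_def by blast
qed

lemma openin_basic_open:
  assumes "N \<in> C4_free_class" "finite V"
  shows "openin C4_free_topology (basic_open V (restrict_graph N V))"
  unfolding C4_free_topology_def
proof (rule topology_generated_by_Basis, rule CollectI)
  show "\<exists>W A. basic_open V (restrict_graph N V) = basic_open W A \<and>
      finite W \<and> is_graph W A \<and> C4_free W A"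
    by (intro exI conjI) (rule refl, rule assms(2), rule restrict_graph_C4_free[OF assms(1)],
        rule restrict_graph_C4_free[OF assms(1)])
qed

lemma topspace_C4_free_topology [simp]: "topspace C4_free_topology = C4_free_class"
proof
  show "topspace C4_free_topology \<subseteq> C4_free_class"
    unfolding C4_free_topology_def topology_generated_by_topspace by (auto simp: basic_open_def)
  show "C4_free_class \<subseteq> topspace C4_free_topology"
  proof
    fix N assume N: "N \<in> C4_free_class"
    then have "N \<in> basic_open {} (restrict_graph N {})"
      by (simp add: basic_open_def)
    then show "N \<in> topspace C4_free_topology"
      using openin_subset[OF openin_basic_open[OF N finite.emptyI]] by blast
  qed
qed

text \<open>The generating sets are not merely a subbasis but a basis of the topology.\<close>

lemma openin_C4_free_topology:
  "openin C4_free_topology U \<longleftrightarrow> U \<subseteq> C4_free_class \<and>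
     (\<forall>N\<in>U. \<exists>V. finite V \<and> basic_open V (restrict_graph N V) \<subseteq> U)"
  (is "_ \<longleftrightarrow> ?R U")
proof
  assume "openin C4_free_topology U"
  then have "generate_topology_on {basic_open V A | V A. finite V \<and> is_graph V A \<and> C4_free V A} U"
    unfolding C4_free_topology_def by (rule openin_topology_generated_by)
  then show "?R U"
  proof induction
    case Empty
    then show ?case by simp
  next
    case (Int a b)
    show ?case
    proof (intro conjI ballI)
      show "a \<inter> b \<subseteq> C4_free_class" using Int by auto
      fix N assume "N \<in> a \<inter> b"
      then obtain V W where "finite V" "finite W"
        and V: "basic_open V (restrict_graph N V) \<subseteq> a"
        and W: "basic_open W (restrict_graph N W) \<subseteq> b"
        using Int by (meson IntD1 IntD2)
      have "basic_open (V \<union> W) (restrict_graph N (V \<union> W))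
          \<subseteq> basic_open V (restrict_graph N V) \<inter> basic_open W (restrict_graph N W)"
        unfolding basic_open_def restrict_graph_def by blast
      then show "\<exists>V. finite V \<and> basic_open V (restrict_graph N V) \<subseteq> a \<inter> b"
        using V W \<open>finite V\<close> \<open>finite W\<close> by (intro exI[of _ "V \<union> W"]) auto
    qed
  next
    case (UN K)
    show ?case
    proof (intro conjI ballI)
      show "\<Union>K \<subseteq> C4_free_class" using UN by blast
      fix N assume "N \<in> \<Union>K"
      then obtain k where k: "k \<in> K" "N \<in> k" by blast
      then obtain V where "finite V" "basic_open V (restrict_graph N V) \<subseteq> k"
        using UN by blast
      then show "\<exists>V. finite V \<and> basic_open V (restrict_graph N V) \<subseteq> \<Union>K"
        using k(1) by blast
    qed
  next
    case (Basis s)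
    then show ?case by (auto simp: basic_open_def)
  qed
next
  assume R: "?R U"
  have "\<exists>T. openin C4_free_topology T \<and> N \<in> T \<and> T \<subseteq> U" if NU: "N \<in> U" for N
  proof -
    obtain V where V: "finite V" "basic_open V (restrict_graph N V) \<subseteq> U"
      using bspec[OF conjunct2[OF R] NU] by blast
    have N: "N \<in> C4_free_class" using subsetD[OF conjunct1[OF R] NU] .
    then have "N \<in> basic_open V (restrict_graph N V)"
      by (simp add: basic_open_def)
    with openin_basic_open[OF N V(1)] V(2) show ?thesis
      by (intro exI[of _ "basic_open V (restrict_graph N V)"] conjI)
  qed
  then show "openin C4_free_topology U"
    by (intro iffD2[OF openin_subopen] ballI)
qed

end

theory Submission
  imports Defs "HOL-Number_Theory.Cong"
begin

text \<open>In a \<open>C\<^sub>4\<close>-free graph two distinct vertices have at most one common neighbour, so an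
  embedding into a fixed \<open>C\<^sub>4\<close>-free graph \<open>G\<close> is determined on the closure of a finite set \<open>A\<close> under
  common neighbours by its values on \<open>A\<close>. Let \<open>A\<close> span three disjoint stars. By the friendship
  theorem the closure of \<open>A\<close> in a finite graph \<open>B\<close> contains two vertices without a common
  neighbour in \<open>B\<close>; attaching new vertices to such pairs, \<open>B\<close> gets two extensions that cannot
  both embed into \<open>G\<close> with the same values on \<open>A\<close>. Hence, for each of the countably many maps
  \<open>A \<rightarrow> G\<close>, the graphs containing \<open>A\<close> that are isomorphic to \<open>G\<close> by an extension of this map form
  a nowhere dense set, so the isomorphism class of \<open>G\<close> is meager in the open set given by \<open>A\<close>.\<close>

section \<open>The regular case of the friendship theorem\<close>

lemma funpow_mult_fixed:
  assumes "(g ^^ d) x = x"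
  shows "(g ^^ (d * n)) x = x"
  using assms by (induction n) (simp_all add: funpow_add)

text \<open>An action of the cyclic group of order \<open>p\<close> without fixed points has only
  orbits of size \<open>p\<close>. The induction removes one orbit at a time.\<close>

lemma prime_dvd_card_if_no_fixpoint:
  assumes "finite W" "prime (p::nat)" "g ` W \<subseteq> W"
    and "\<And>x. x \<in> W \<Longrightarrow> (g ^^ p) x = x" "\<And>x. x \<in> W \<Longrightarrow> g x \<noteq> x"
  shows "p dvd card W"
  using assms(1,3-5)
proof (induction W rule: finite_psubset_induct)
  case (psubset W)
  show ?case
  proof (cases "W = {}")
    case False
    then obtain x where x: "x \<in> W" by blast
    define Orb where "Orb = (\<lambda>i. (g ^^ i) x) ` {..<p}"
    have in_W: "(g ^^ i) x \<in> W" for i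
      using x psubset.prems(1) by (induction i) auto
    have mod: "(g ^^ i) x = (g ^^ (i mod p)) x" for i
    proof -
      have "(g ^^ i) x = (g ^^ (i mod p + p * (i div p))) x" by simp
      also have "\<dots> = (g ^^ (i mod p)) x"
        using funpow_mult_fixed[OF psubset.prems(2)[OF x]] by (simp only: funpow_add o_apply)
      finally show ?thesis .
    qed
    have p0: "0 < p" using assms(2) by (rule prime_gt_0_nat)
    have Orb: "(g ^^ i) x \<in> Orb" for i
      unfolding Orb_def using mod[of i] p0 by (intro image_eqI[where x = "i mod p"]) auto
    have neq: "(g ^^ i) x \<noteq> (g ^^ j) x" if "i < j" "j < p" for i j
    proof
      assume eq: "(g ^^ i) x = (g ^^ j) x"
      have "x = (g ^^ (p - i)) ((g ^^ i) x)"
        using that psubset.prems(2)[OF x] by (simp flip: funpow_add[unfolded comp_def, THEN fun_cong])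
      also have "\<dots> = (g ^^ (p - i + j)) x"
        by (simp add: eq funpow_add)
      also have "\<dots> = (g ^^ (j - i)) x"
        using that mod[of "p - i + j"] by (simp add: mod_if)
      finally have d: "(g ^^ (j - i)) x = x" by simp
      have "\<not> p dvd (j - i)" using that by (auto dest: dvd_imp_le)
      then have "coprime (j - i) p"
        using prime_imp_coprime[OF assms(2)] by (metis coprime_commute)
      \<comment> \<open>Both \<open>g ^^ (j - i)\<close> and \<open>g ^^ p\<close> fix
        \<open>x\<close>; by Bezout, so does \<open>g\<close> itself, contrary to the
        assumption.\<close>
      then obtain a b where ab: "(j - i) * a = p * b + 1"
        using that coprime_bezout_strong[of "j - i" p] assms(2) prime_gt_1_nat by fastforce
      have "x = (g ^^ ((j - i) * a)) x" using funpow_mult_fixed[OF d] by simp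
      also have "\<dots> = g ((g ^^ (p * b)) x)" by (simp only: ab) simp
      also have "\<dots> = g x" using funpow_mult_fixed[OF psubset.prems(2)[OF x]] by simp
      finally show False using psubset.prems(3)[OF x] by simp
    qed
    have "inj_on (\<lambda>i. (g ^^ i) x) {..<p}"
      by (rule linorder_inj_onI') (use neq in auto)
    then have card_Orb: "card Orb = p" by (simp add: Orb_def card_image)
    have Orb_W: "Orb \<subseteq> W" using in_W by (auto simp: Orb_def)
    have "p dvd card (W - Orb)"
    proof (rule psubset.IH)
      show "W - Orb \<subset> W" using Orb_W Orb[of 0] by auto
      show "g ` (W - Orb) \<subseteq> W - Orb"
      proof clarsimp
        fix y assume y: "y \<in> W" "y \<notin> Orb"
        have "g y \<notin> Orb"
        proof
          assume "g y \<in> Orb"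
          then obtain i where i: "g y = (g ^^ i) x" by (auto simp: Orb_def)
          \<comment> \<open>On \<open>W\<close> the map \<open>g\<close> is inverted by
            \<open>g ^^ (p - 1)\<close>, so \<open>g\<close> cannot lead into the orbit from
            outside.\<close>
          have "y = (g ^^ (p - 1)) (g y)"
            using psubset.prems(2)[OF y(1)] p0
            by (cases p) (simp_all add: funpow_swap1)
          also have "\<dots> = (g ^^ (p - 1 + i)) x" by (simp add: i funpow_add)
          finally show False using Orb[of "p - 1 + i"] y(2) by simp
        qed
        then show "g y \<in> W \<and> g y \<notin> Orb" using y psubset.prems(1) by blast
      qed
    qed (use psubset.prems in auto)
    moreover have "card W = card (W - Orb) + p"
      using card_Orb Orb_W psubset.hyps by (metis card_Diff_subset card_mono finite_subset le_add_diff_inverse2)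
    ultimately show ?thesis by simp
  qed simp
qed

section \<open>Counting walks in a friendship graph\<close>

locale friendship_graph =
  fixes S :: "'a set" and E :: "('a \<times> 'a) set"
  assumes fin: "finite S" and symE: "sym E" and irr: "irrefl E"
    and friend: "\<lbrakk>u \<in> S; v \<in> S; u \<noteq> v\<rbrakk> \<Longrightarrow> \<exists>!x. x \<in> S \<and> (u, x) \<in> E \<and> (v, x) \<in> E"
begin

text \<open>Edges of \<open>E\<close> may leave \<open>S\<close>, since \<open>S\<close> will be a
  closure inside a larger graph; hence the restriction to \<open>S\<close>.\<close>

definition nbrs :: "'a \<Rightarrow> 'a set" where
  "nbrs u = {x \<in> S. (u, x) \<in> E}"

text \<open>The parameter counts vertices: a member of \<open>walks m\<close> has
  \<open>m - 1\<close> edges for positive \<open>m\<close>. The closing edge in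
  \<open>closed_walks\<close> makes rotation of lists act there.\<close>

definition walks :: "nat \<Rightarrow> 'a list set" where
  "walks m = {xs. length xs = m \<and> set xs \<subseteq> S \<and> successively (\<lambda>x y. (x, y) \<in> E) xs}"

definition closed_walks :: "nat \<Rightarrow> 'a list set" where
  "closed_walks m = {xs \<in> walks m. (last xs, hd xs) \<in> E}"

lemma sym_iff: "(x, y) \<in> E \<longleftrightarrow> (y, x) \<in> E"
  using symE by (auto dest: symD)

lemma finite_nbrs [simp]: "finite (nbrs u)"
  using fin by (simp add: nbrs_def)

lemma finite_walks: "finite (walks m)"
  by (rule finite_subset[OF _ finite_lists_length_eq[OF fin, of m]]) (auto simp: walks_def)

lemma card_common_nbrs:
  assumes "u \<in> S" "v \<in> S" "u \<noteq> v"
  shows "card (nbrs u \<inter> nbrs v) = 1"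
proof -
  have "is_singleton (nbrs u \<inter> nbrs v)"
    using friend[OF assms] unfolding is_singleton_def nbrs_def by blast
  then show ?thesis by (simp add: is_singleton_altdef)
qed

lemma common_nbr_unique:
  assumes "u \<in> S" "v \<in> S" "u \<noteq> v" "x \<in> S" "y \<in> S"
    "(u, x) \<in> E" "(v, x) \<in> E" "(u, y) \<in> E" "(v, y) \<in> E"
  shows "x = y"
  using friend[OF assms(1-3)] assms by blast

text \<open>Send a neighbour \<open>x\<close> of \<open>u\<close> to the common neighbour
  \<open>c x\<close> of \<open>x\<close> and \<open>v\<close>. If \<open>c x = c y\<close>, then
  \<open>x\<close> and \<open>y\<close> are both common neighbours of \<open>u\<close> and
  \<open>c x\<close>, which differ because \<open>v\<close> is adjacent only to the latter.\<close>

lemma card_nbrs_le: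
  assumes "u \<in> S" "v \<in> S" "(u, v) \<notin> E"
  shows "card (nbrs u) \<le> card (nbrs v)"
proof (cases "u = v")
  case False
  define c where "c x = (THE y. y \<in> S \<and> (x, y) \<in> E \<and> (v, y) \<in> E)" for x
  have c: "c x \<in> S \<and> (x, c x) \<in> E \<and> (v, c x) \<in> E" if "x \<in> nbrs u" for x
    unfolding c_def by (rule theI', rule friend) (use that assms in \<open>auto simp: nbrs_def\<close>)
  show ?thesis
  proof (rule card_inj_on_le)
    show "inj_on c (nbrs u)"
    proof (rule inj_onI)
      fix x y assume xy: "x \<in> nbrs u" "y \<in> nbrs u" "c x = c y"
      have "u \<noteq> c x" using c[OF xy(1)] assms sym_iff by blast
      then show "x = y"
        using common_nbr_unique[of u "c x" x y] c[OF xy(1)] c[OF xy(2)] xy assms sym_iff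
        by (auto simp: nbrs_def)
    qed
  qed (use c in \<open>auto simp: nbrs_def fin\<close>)
qed simp

lemma card_nbrs_eq:
  assumes "u \<in> S" "v \<in> S" "(u, v) \<notin> E"
  shows "card (nbrs u) = card (nbrs v)"
  using card_nbrs_le[of u v] card_nbrs_le[of v u] assms sym_iff by fastforce

context
  fixes k :: nat
  assumes regular: "\<And>u. u \<in> S \<Longrightarrow> card (nbrs u) = k"
begin

text \<open>Every vertex other than \<open>v\<close> is adjacent to exactly one of the
  \<open>k\<close> neighbours of \<open>v\<close>, and each of these has \<open>k - 1\<close>
  neighbours besides \<open>v\<close>.\<close>

lemma card_verts:
  assumes v: "v \<in> S"
  shows "card S = k * (k - 1) + 1"
proof -
  have S: "S - {v} = (\<Union>x\<in>nbrs v. nbrs x - {v})" (is "?L = ?R")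
  proof
    show "?L \<subseteq> ?R" using friend[OF v] sym_iff by (fastforce simp: nbrs_def)
    show "?R \<subseteq> ?L" by (auto simp: nbrs_def)
  qed
  have "card ?R = (\<Sum>x\<in>nbrs v. card (nbrs x - {v}))"
  proof (rule card_UN_disjoint)
    show "\<forall>x\<in>nbrs v. \<forall>y\<in>nbrs v. x \<noteq> y \<longrightarrow> (nbrs x - {v}) \<inter> (nbrs y - {v}) = {}"
    proof (intro ballI impI equals0I)
      fix x y t
      assume "x \<in> nbrs v" "y \<in> nbrs v" "x \<noteq> y" "t \<in> (nbrs x - {v}) \<inter> (nbrs y - {v})"
      then show False
        using common_nbr_unique[OF v, of t x y] sym_iff[of x t] sym_iff[of y t]
        by (auto simp: nbrs_def)
    qed
  qed auto
  also have "\<dots> = (\<Sum>x\<in>nbrs v. k - 1)"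
  proof (rule sum.cong[OF refl])
    fix x assume x: "x \<in> nbrs v"
    then have "v \<in> nbrs x" using v sym_iff by (auto simp: nbrs_def)
    then show "card (nbrs x - {v}) = k - 1" using x regular by (auto simp: nbrs_def)
  qed
  also have "\<dots> = k * (k - 1)" using regular[OF v] by simp
  finally have "card (S - {v}) = k * (k - 1)" using S by simp
  then show ?thesis using card_Suc_Diff1[OF fin v] by simp
qed

lemma card_walks: "card (walks (Suc m)) = card S * k ^ m"
proof (induction m)
  case 0
  have "walks (Suc 0) = (\<lambda>x. [x]) ` S"
    by (auto simp: walks_def length_Suc_conv)
  then show ?case by (simp add: card_image inj_on_def)
next
  case (Suc m)
  have "walks (Suc (Suc m)) = (\<lambda>(xs, x). x # xs) ` (SIGMA xs:walks (Suc m). nbrs (hd xs))"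
    (is "?L = ?f ` ?R")
  proof (intro subset_antisym subsetI)
    fix xs assume "xs \<in> ?L"
    then obtain x ys where "xs = x # ys" "(ys, x) \<in> ?R"
      using sym_iff by (auto simp: walks_def nbrs_def length_Suc_conv)
    then show "xs \<in> ?f ` ?R" by force
  next
    fix xs assume "xs \<in> ?f ` ?R"
    then show "xs \<in> ?L"
      using sym_iff by (auto simp: walks_def nbrs_def length_Suc_conv)
  qed
  moreover have "inj_on ?f ?R" by (auto simp: inj_on_def)
  ultimately have "card ?L = card ?R" by (simp add: card_image)
  also have "\<dots> = (\<Sum>xs\<in>walks (Suc m). card (nbrs (hd xs)))"
    by (rule card_SigmaI) (auto simp: finite_walks)
  also have "\<dots> = (\<Sum>xs\<in>walks (Suc m). k)"
    by (rule sum.cong) (auto simp: walks_def length_Suc_conv intro!: regular)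
  finally show ?case using Suc by simp
qed

text \<open>Deleting the first vertex leaves a walk to whose two ends that vertex was adjacent:
  \<open>k\<close> choices if the ends coincide, one otherwise. Modulo a divisor of
  \<open>k - 1\<close> both weights become 1.\<close>

lemma card_closed_walks:
  "card (closed_walks (Suc (Suc m))) =
    (\<Sum>xs\<in>walks (Suc m). if hd xs = last xs then k else 1)"
proof -
  have "closed_walks (Suc (Suc m)) =
      (\<lambda>(xs, x). x # xs) ` (SIGMA xs:walks (Suc m). nbrs (hd xs) \<inter> nbrs (last xs))"
    (is "?L = ?f ` ?R")
  proof (intro subset_antisym subsetI)
    fix xs assume "xs \<in> ?L"
    then obtain x ys where "xs = x # ys" "(ys, x) \<in> ?R"
      using sym_iff by (auto simp: closed_walks_def walks_def nbrs_def length_Suc_conv)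
    then show "xs \<in> ?f ` ?R" by force
  next
    fix xs assume "xs \<in> ?f ` ?R"
    then show "xs \<in> ?L"
      using sym_iff by (auto simp: closed_walks_def walks_def nbrs_def length_Suc_conv)
  qed
  moreover have "inj_on ?f ?R" by (auto simp: inj_on_def)
  ultimately have "card ?L = card ?R" by (simp add: card_image)
  also have "\<dots> = (\<Sum>xs\<in>walks (Suc m). card (nbrs (hd xs) \<inter> nbrs (last xs)))"
    by (rule card_SigmaI) (auto simp: finite_walks)
  also have "\<dots> = (\<Sum>xs\<in>walks (Suc m). if hd xs = last xs then k else 1)"
  proof (rule sum.cong[OF refl])
    fix xs assume "xs \<in> walks (Suc m)"
    then have "xs \<noteq> []" "set xs \<subseteq> S" by (auto simp: walks_def)
    then have "hd xs \<in> S" "last xs \<in> S" by auto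
    then show "card (nbrs (hd xs) \<inter> nbrs (last xs)) = (if hd xs = last xs then k else 1)"
      using card_common_nbrs regular by auto
  qed
  finally show ?thesis .
qed

text \<open>Orbits under rotation are counted; a list fixed by \<open>rotate1\<close> would begin
  with two equal vertices, that is, with a loop.\<close>

lemma prime_dvd_card_closed_walks:
  assumes "prime p"
  shows "p dvd card (closed_walks p)"
proof (rule prime_dvd_card_if_no_fixpoint[where g = rotate1, OF _ assms])
  show "finite (closed_walks p)" using finite_walks by (simp add: closed_walks_def)
  have "\<exists>x y ys. xs = x # y # ys" if "xs \<in> closed_walks p" for xs
  proof -
    have "length xs \<ge> 2" using that prime_ge_2_nat[OF assms] by (simp add: closed_walks_def walks_def)
    then show ?thesis by (cases xs; cases "tl xs") auto
  qed
  note xs = this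
  show "rotate1 xs \<noteq> xs" if "xs \<in> closed_walks p" for xs
    using xs[OF that] that irr by (auto simp: closed_walks_def walks_def irrefl_def)
  show "rotate1 ` closed_walks p \<subseteq> closed_walks p"
  proof clarify
    fix xs assume "xs \<in> closed_walks p"
    with xs[OF this] show "rotate1 xs \<in> closed_walks p"
      by (auto simp: closed_walks_def walks_def successively_append_iff
          simp flip: append_Cons)
  qed
  show "(rotate1 ^^ p) xs = xs" if "xs \<in> closed_walks p" for xs
    using that rotate_id[of p xs] by (simp add: closed_walks_def walks_def rotate_def)
qed

text \<open>For a prime \<open>p\<close> dividing \<open>k - 1\<close>, the number of closed walks of length \<open>p\<close> is \<open>1\<close> modulo
  \<open>p\<close>; but it is divisible by \<open>p\<close>, since without loops rotation has no fixed points.\<close>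

lemma regular_degree_le_2:
  assumes v: "v \<in> S"
  shows "k \<le> 2"
proof (rule ccontr)
  assume "\<not> k \<le> 2"
  then obtain p where p: "prime p" "p dvd k - 1"
    using prime_factor_nat[of "k - 1"] by fastforce
  obtain m where m: "p = Suc (Suc m)"
    using prime_ge_2_nat[OF p(1)] by (metis add_2_eq_Suc le_Suc_ex)
  have k1: "[k = 1] (mod p)"
    using p(2) \<open>\<not> k \<le> 2\<close> by (simp add: cong_altdef_nat)
  have n1: "[card S = 1] (mod p)"
    using p(2) by (simp add: card_verts[OF v] cong_altdef_nat)
  have "[card (closed_walks p) = (\<Sum>xs\<in>walks (Suc m). 1)] (mod p)"
    unfolding m card_closed_walks by (rule cong_sum) (use k1 in \<open>simp add: m\<close>)
  also have "(\<Sum>xs\<in>walks (Suc m). 1) = card S * k ^ m"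
    by (simp add: card_walks)
  also have "[card S * k ^ m = 1 * 1 ^ m] (mod p)"
    by (intro cong_mult cong_pow n1 k1)
  finally have "[card (closed_walks p) = 1] (mod p)" by simp
  then have "p dvd 1"
    using prime_dvd_card_closed_walks[OF p(1)] cong_dvd_iff by blast
  then show False using p(1) by simp
qed

end

text \<open>A vertex other than \<open>z\<close> cannot be adjacent to both \<open>a\<close> and
  \<open>b\<close>, so nonadjacency links its degree to that of \<open>y\<close>. The graph is thus
  regular, of degree at most 2, and has at most 3 vertices, whereas \<open>z\<close>,
  \<open>a\<close>, \<open>b\<close>, \<open>y\<close> are distinct.\<close>

lemma no_path_with_nonadjacent_vertex:
  assumes "z \<in> S" "a \<in> S" "b \<in> S" "y \<in> S" "(z, a) \<in> E" "(z, b) \<in> E" "a \<noteq> b"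
    and "(y, z) \<notin> E" "(y, a) \<notin> E" "(y, b) \<notin> E"
  shows False
proof -
  have "card (nbrs x) = card (nbrs y)" if x: "x \<in> S" for x
  proof (cases "x = z")
    case True
    then show ?thesis using card_nbrs_eq assms by metis
  next
    case False
    then have "(x, a) \<notin> E \<or> (x, b) \<notin> E"
      using common_nbr_unique[of a b x z] assms x sym_iff by blast
    then show ?thesis using card_nbrs_eq assms x by metis
  qed
  note reg = this
  have k: "card (nbrs y) \<le> 2"
    using regular_degree_le_2[of "card (nbrs y)", OF reg assms(1)] by simp
  have n: "card S = card (nbrs y) * (card (nbrs y) - 1) + 1"
    using card_verts[of "card (nbrs y)", OF reg assms(1)] by simp
  have "z \<noteq> a" "z \<noteq> b" "y \<noteq> z" "y \<noteq> a" "y \<noteq> b"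
    using assms irr sym_iff by (auto simp: irrefl_def)
  then have "card {z, a, b, y} = 4" using assms by simp
  then have "4 \<le> card S" using assms card_mono[OF fin, of "{z, a, b, y}"] by simp
  moreover have "card (nbrs y) * (card (nbrs y) - 1) \<le> 2 * 1"
    using k by (intro mult_mono) auto
  ultimately show False using n by simp
qed

end

section \<open>Countable graphs without 4-cycles\<close>

lemma C4_edges_eq: "C4_edges = {(0,1),(1,0),(1,2),(2,1),(2,3),(3,2),(3,0),(0,3)}"
proof -
  have less4: "i < 4 \<longleftrightarrow> i = 0 \<or> i = 1 \<or> i = 2 \<or> i = 3" for i :: nat
    by linarith
  show ?thesis unfolding C4_edges_def less4 by auto
qed

lemma C4_verts_eq: "C4_verts = {0,1,2,3}"
  unfolding C4_verts_def by auto

text \<open>Here \<open>a\<close>, \<open>b\<close> and \<open>x\<close>, \<open>y\<close> are the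
  two pairs of opposite corners of a 4-cycle; irreflexivity separates adjacent corners.\<close>

lemma C4_free_class_iff:
  "E \<in> C4_free_class \<longleftrightarrow> sym E \<and> irrefl E \<and>
    (\<forall>a b x y. (a, x) \<in> E \<longrightarrow> (b, x) \<in> E \<longrightarrow> (a, y) \<in> E \<longrightarrow> (b, y) \<in> E \<longrightarrow> a = b \<or> x = y)"
  (is "_ \<longleftrightarrow> _ \<and> _ \<and> ?U")
proof -
  have "C4_free UNIV E \<longleftrightarrow> ?U" if E: "sym E" "irrefl E"
  proof
    assume free: "C4_free UNIV E"
    show ?U
    proof (intro allI impI, rule ccontr)
      fix a b x y assume e: "(a, x) \<in> E" "(b, x) \<in> E" "(a, y) \<in> E" "(b, y) \<in> E"
        and ne: "\<not> (a = b \<or> x = y)"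
      define f :: "nat \<Rightarrow> nat" where
        "f i = (if i = 0 then a else if i = 1 then x else if i = 2 then b else y)" for i
      have "a \<noteq> x" "b \<noteq> x" "a \<noteq> y" "b \<noteq> y" using e E by (auto simp: irrefl_def)
      then have "inj_on f C4_verts" using ne by (auto simp: C4_verts_eq f_def inj_on_def)
      moreover have "graph_hom C4_verts C4_edges UNIV E f"
        using e E by (auto simp: graph_hom_def C4_edges_eq f_def dest: symD)
      ultimately show False using free unfolding C4_free_def by blast
    qed
  next
    assume U: ?U
    show "C4_free UNIV E"
      unfolding C4_free_def
    proof
      assume "\<exists>f. graph_hom C4_verts C4_edges UNIV E f \<and> inj_on f C4_verts"
      then obtain f where f: "graph_hom C4_verts C4_edges UNIV E f" "inj_on f C4_verts" by blast
      then have "(f 0, f 1) \<in> E" "(f 2, f 1) \<in> E" "(f 0, f 3) \<in> E" "(f 2, f 3) \<in> E"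
        by (auto simp: graph_hom_def C4_edges_eq C4_verts_eq)
      then have "f 0 = f 2 \<or> f 1 = f 3" using U by blast
      then show False using f(2) by (auto simp: C4_verts_eq inj_on_def)
    qed
  qed
  then show ?thesis by (auto simp: C4_free_class_def is_graph_def)
qed

lemma C4_free_classD:
  assumes "E \<in> C4_free_class"
  shows "(x, y) \<in> E \<Longrightarrow> (y, x) \<in> E" "(x, x) \<notin> E"
    "\<lbrakk>(a, x) \<in> E; (b, x) \<in> E; (a, y) \<in> E; (b, y) \<in> E; a \<noteq> b\<rbrakk> \<Longrightarrow> x = y"
proof -
  have E: "sym E" "irrefl E"
    "\<forall>a b x y. (a, x) \<in> E \<longrightarrow> (b, x) \<in> E \<longrightarrow> (a, y) \<in> E \<longrightarrow> (b, y) \<in> E \<longrightarrow> a = b \<or> x = y"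
    using assms unfolding C4_free_class_iff by simp_all
  show "(x, y) \<in> E \<Longrightarrow> (y, x) \<in> E" using E(1) by (rule symD)
  show "(x, x) \<notin> E" using E(2) by (simp add: irrefl_def)
  show "\<lbrakk>(a, x) \<in> E; (b, x) \<in> E; (a, y) \<in> E; (b, y) \<in> E; a \<noteq> b\<rbrakk> \<Longrightarrow> x = y"
    using E(3) by blast
qed

lemma C4_free_classI:
  assumes "\<And>x y. (x, y) \<in> E \<Longrightarrow> (y, x) \<in> E" "\<And>x. (x, x) \<notin> E"
    "\<And>a b x y. \<lbrakk>(a, x) \<in> E; (b, x) \<in> E; (a, y) \<in> E; (b, y) \<in> E; a \<noteq> b; x \<noteq> y\<rbrakk> \<Longrightarrow> False"
  shows "E \<in> C4_free_class"
  unfolding C4_free_class_iff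
proof (intro conjI)
  show "sym E" using assms(1) by (rule symI)
  show "irrefl E" using assms(2) by (rule irreflI)
qed (use assms(3) in metis)

lemma restrict_graph_in_class:
  assumes "N \<in> C4_free_class"
  shows "restrict_graph N V \<in> C4_free_class"
proof (rule C4_free_classI)
  fix a b x y
  assume "(a, x) \<in> restrict_graph N V" "(b, x) \<in> restrict_graph N V"
    "(a, y) \<in> restrict_graph N V" "(b, y) \<in> restrict_graph N V" "a \<noteq> b" "x \<noteq> y"
  then show False using C4_free_classD(3)[OF assms, of a x b y] by (simp add: restrict_graph_def)
qed (use C4_free_classD(1,2)[OF assms] in \<open>auto simp: restrict_graph_def\<close>)

section \<open>Attaching a new vertex\<close>

definition unlinked :: "('a \<times> 'a) set \<Rightarrow> 'a set \<Rightarrow> bool" where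
  "unlinked E T \<longleftrightarrow> (\<forall>u\<in>T. \<forall>v\<in>T. u \<noteq> v \<longrightarrow> (\<forall>x. (u, x) \<in> E \<longrightarrow> (v, x) \<notin> E))"

definition add_vertex :: "('a \<times> 'a) set \<Rightarrow> 'a \<Rightarrow> 'a set \<Rightarrow> ('a \<times> 'a) set" where
  "add_vertex E w T = E \<union> {w} \<times> T \<union> T \<times> {w}"

text \<open>A 4-cycle through \<open>w\<close> would pass through two members of \<open>T\<close>
  and a further common neighbour of theirs, which \<open>unlinked\<close> excludes. Members of
  \<open>T\<close> may be adjacent, as only a triangle arises.\<close>

lemma add_vertex_in_class:
  assumes E: "E \<in> C4_free_class" and w: "\<And>y. (w, y) \<notin> E" "w \<notin> T" and T: "unlinked E T"
  shows "add_vertex E w T \<in> C4_free_class"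
proof -
  note E' = C4_free_classD[OF E]
  have w': "(y, w) \<notin> E" for y using E' w by blast
  have mem: "(x, y) \<in> add_vertex E w T \<longleftrightarrow>
      (if x = w then y \<in> T else if y = w then x \<in> T else (x, y) \<in> E)" for x y
    using w w' by (auto simp: add_vertex_def)
  have T': "\<lbrakk>u \<in> T; v \<in> T; (u, x) \<in> E; (v, x) \<in> E\<rbrakk> \<Longrightarrow> u = v" for u v x
    using T unfolding unlinked_def by blast
  show ?thesis
  proof (rule C4_free_classI)
    fix a b x y
    assume e: "(a, x) \<in> add_vertex E w T" "(b, x) \<in> add_vertex E w T"
      "(a, y) \<in> add_vertex E w T" "(b, y) \<in> add_vertex E w T" and ne: "a \<noteq> b" "x \<noteq> y"
    consider "a = w" | "b = w" | "x = w" | "y = w" | "w \<notin> {a, b, x, y}" by auto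
    then show False
    proof cases
      case 1
      then show False using e ne w(2) T'[of x y b] E'(1) by (auto simp: mem split: if_splits)
    next
      case 2
      then show False using e ne w(2) T'[of x y a] E'(1) by (auto simp: mem split: if_splits)
    next
      case 3
      then show False using e ne w(2) T'[of a b y] by (auto simp: mem split: if_splits)
    next
      case 4
      then show False using e ne w(2) T'[of a b x] by (auto simp: mem split: if_splits)
    next
      case 5
      then show False using e ne E'(3)[of a x b y] by (auto simp: mem)
    qed
  qed (use E'(1,2) w(2) in \<open>auto simp: mem split: if_splits\<close>)
qed

section \<open>Closure under common neighbours and its rigidity\<close>

inductive_set common_nbr_closure :: "('a \<times> 'a) set \<Rightarrow> 'a set \<Rightarrow> 'a set"
  for E :: "('a \<times> 'a) set" and A :: "'a set" where
  base: "a \<in> A \<Longrightarrow> a \<in> common_nbr_closure E A"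
| step: "\<lbrakk>u \<in> common_nbr_closure E A; v \<in> common_nbr_closure E A; u \<noteq> v; (u, x) \<in> E; (v, x) \<in> E\<rbrakk>
    \<Longrightarrow> x \<in> common_nbr_closure E A"

lemma common_nbr_closure_mono:
  assumes "E \<subseteq> F" "x \<in> common_nbr_closure E A"
  shows "x \<in> common_nbr_closure F A"
  using assms(2) by induction (use assms(1) in \<open>auto intro: common_nbr_closure.intros\<close>)

lemma common_nbr_closure_subset:
  assumes "A \<subseteq> V" "E \<subseteq> V \<times> V"
  shows "common_nbr_closure E A \<subseteq> V"
proof
  fix x assume "x \<in> common_nbr_closure E A"
  then show "x \<in> V" by induction (use assms in auto)
qed

text \<open>Inductively, \<open>f x\<close> and \<open>g x\<close> are common neighbours in
  \<open>G\<close> of the same two distinct vertices. As edges of \<open>E\<close> need only be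
  preserved, \<open>f\<close> and \<open>g\<close> may embed different graphs containing
  \<open>E\<close>.\<close>

lemma embeddings_agree_on_closure:
  assumes G: "G \<in> C4_free_class" and "inj f"
    and f: "\<And>x y. (x, y) \<in> E \<Longrightarrow> (f x, f y) \<in> G" and g: "\<And>x y. (x, y) \<in> E \<Longrightarrow> (g x, g y) \<in> G"
    and A: "\<And>a. a \<in> A \<Longrightarrow> f a = g a"
    and x: "x \<in> common_nbr_closure E A"
  shows "f x = g x"
  using x
proof induction
  case (step u v x)
  then have "f u \<noteq> f v" using \<open>inj f\<close> by (metis injD)
  then show ?case
    using C4_free_classD(3)[OF G, of "f u" "f x" "f v" "g x"] f g step by metis
qed (rule A)

section \<open>Two incompatible extensions\<close>

text \<open>Three centres, so that one of them avoids any given pair \<open>u\<close>, \<open>v\<close>; six leaves each, since at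
  most four leaves of that centre belong to \<open>{u, v}\<close> or are adjacent to \<open>u\<close> or \<open>v\<close>.\<close>

definition three_stars :: "(nat \<times> nat) set" where
  "three_stars = {(i, j). i < 21 \<and> j < 21 \<and>
     (i < 3 \<and> 3 \<le> j \<and> j mod 3 = i \<or> j < 3 \<and> 3 \<le> i \<and> i mod 3 = j)}"

text \<open>The only neighbour of a leaf is its residue modulo 3, and every edge contains a
  leaf.\<close>

lemma three_stars_in_class: "three_stars \<in> C4_free_class"
proof (rule C4_free_classI)
  fix a b x y
  assume e: "(a, x) \<in> three_stars" "(b, x) \<in> three_stars" "(a, y) \<in> three_stars"
    "(b, y) \<in> three_stars" and "a \<noteq> b" "x \<noteq> y"
  show False
  proof (cases "x < 3")
    case True
    then have "x = a mod 3" "3 \<le> a" using e(1) by (auto simp: three_stars_def)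
    moreover from this have "y = a mod 3" using e(3) by (simp add: three_stars_def)
    ultimately show False using \<open>x \<noteq> y\<close> by simp
  next
    case False
    then have "a = x mod 3" "b = x mod 3" using e(1,2) by (simp_all add: three_stars_def)
    then show False using \<open>a \<noteq> b\<close> by simp
  qed
qed (simp_all add: three_stars_def disj_commute)

lemma restrict_three_stars: "restrict_graph three_stars {..<21} = three_stars"
  by (auto simp: three_stars_def restrict_graph_def)

text \<open>Otherwise the closure, which contains all common neighbours of its members, would be a
  finite friendship graph.\<close>

lemma closure_three_stars_unlinked_pair:
  assumes B: "B \<in> C4_free_class" "finite B" and stars: "restrict_graph B {..<21} = three_stars"
  obtains u v where "u \<in> common_nbr_closure B {..<21}" "v \<in> common_nbr_closure B {..<21}"
    "u \<noteq> v" "unlinked B {u, v}"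
proof (rule ccontr)
  assume contr: "\<not> thesis"
  let ?S = "common_nbr_closure B {..<21}"
  note B' = C4_free_classD[OF B(1)]
  have iff: "(i, j) \<in> B \<longleftrightarrow> (i, j) \<in> three_stars" if "i < 21" "j < 21" for i j
    using that unfolding stars[symmetric] restrict_graph_def by auto
  interpret friendship_graph ?S B
  proof
    have "?S \<subseteq> {..<21} \<union> fst ` B \<union> snd ` B"
      by (rule common_nbr_closure_subset) force+
    then show "finite ?S" using B(2) by (auto intro: finite_subset)
    show "sym B" "irrefl B" using B' by (auto simp: sym_def irrefl_def)
    fix u v assume uv: "u \<in> ?S" "v \<in> ?S" "u \<noteq> v"
    then have "\<not> unlinked B {u, v}" using contr that by blast
    then obtain x where x: "(u, x) \<in> B" "(v, x) \<in> B" unfolding unlinked_def by blast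
    then have "x \<in> ?S" using uv by (blast intro: common_nbr_closure.step)
    then show "\<exists>!x. x \<in> ?S \<and> (u, x) \<in> B \<and> (v, x) \<in> B"
      using x B'(3) uv(3) by blast
  qed
  show False
    \<comment> \<open>The path 3, 0, 6 lies in the star with centre 0; the centre 1 of another star
      is adjacent to none of its vertices.\<close>
    by (rule no_path_with_nonadjacent_vertex[of 0 3 6 1])
      (auto intro!: common_nbr_closure.base simp: iff three_stars_def)
qed

lemma two_free_leaves:
  assumes B: "B \<in> C4_free_class" and stars: "restrict_graph B {..<21} = three_stars"
  obtains x y where "x < 21" "y < 21" "x \<noteq> y" "(x, y) \<notin> B" "{x, y} \<inter> {u, v} = {}"
    "(u, x) \<notin> B" "(v, x) \<notin> B" "(u, y) \<notin> B" "(v, y) \<notin> B"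
proof -
  note B' = C4_free_classD[OF B]
  have iff: "(i, j) \<in> B \<longleftrightarrow> (i, j) \<in> three_stars" if "i < 21" "j < 21" for i j
    using that unfolding stars[symmetric] restrict_graph_def by auto
  obtain z where z: "z < 3" "z \<noteq> u" "z \<noteq> v"
  proof -
    have "\<exists>z<3. z \<noteq> u \<and> z \<noteq> v" by presburger
    then show ?thesis using that by blast
  qed
  define L where "L = (\<lambda>i. z + 3 * i) ` {1..6}"
  have cL: "card L = 6" unfolding L_def by (subst card_image) (auto simp: inj_on_def)
  have L: "3 \<le> x \<and> x < 21 \<and> x mod 3 = z" if "x \<in> L" for x
    using that z by (auto simp: L_def)
  have zL: "(z, x) \<in> B" if "x \<in> L" for x
    using L[OF that] z by (simp add: iff three_stars_def)
  \<comment> \<open>Two leaves adjacent to \<open>t\<close> would be two common neighbours of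
    \<open>t\<close> and \<open>z\<close>.\<close>
  have one: "card {x \<in> L. (t, x) \<in> B} \<le> 1" if "t \<noteq> z" for t
    using B'(3)[of t _ z] zL that by (auto simp: card_le_Suc0_iff_eq L_def)
  define R where "R = L - ({u, v} \<union> {x \<in> L. (u, x) \<in> B} \<union> {x \<in> L. (v, x) \<in> B})"
  have "card ({u, v} \<union> {x \<in> L. (u, x) \<in> B} \<union> {x \<in> L. (v, x) \<in> B}) \<le> 2 + 1 + 1"
    by (intro order_trans[OF card_Un_le] add_mono one)
      (use z in \<open>auto simp: card_insert_if\<close>)
  then have "2 \<le> card R"
    using diff_card_le_card_Diff[of "{u, v} \<union> {x \<in> L. (u, x) \<in> B} \<union> {x \<in> L. (v, x) \<in> B}" L] cL
    unfolding R_def by (simp add: L_def)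
  then obtain x y where xy: "x \<in> R" "y \<in> R" "x \<noteq> y"
    using card_le_Suc0_iff_eq[of R] card.infinite by fastforce
  then have "x \<in> L" "y \<in> L" by (auto simp: R_def)
  then have "(x, y) \<notin> B" using L[of x] L[of y] by (auto simp: iff three_stars_def)
  then show ?thesis
    using that[of x y] xy L by (auto simp: R_def)
qed

text \<open>The vertices \<open>w\<close>, \<open>p\<close>, \<open>q\<close> are determined by the stars in both extensions, which differ only
  in whether \<open>q\<close> is adjacent to \<open>y\<close>.\<close>

lemma incompatible_extensions:
  assumes B: "B \<in> C4_free_class" "B \<subseteq> V \<times> V" "finite V" "{..<21} \<subseteq> V"
    and stars: "restrict_graph B {..<21} = three_stars"
  obtains C D W q y where "C \<in> C4_free_class" "D \<in> C4_free_class" "C \<subseteq> D" "finite W" "V \<subseteq> W"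
    "D \<subseteq> W \<times> W" "restrict_graph C V = B" "restrict_graph D V = B"
    "q \<in> common_nbr_closure C {..<21}" "y < 21" "(q, y) \<in> D" "(q, y) \<notin> C"
proof -
  let ?S = "common_nbr_closure B {..<21}"
  note B' = C4_free_classD[OF B(1)]
  have "finite B" using B by (meson finite_SigmaI finite_subset)
  then obtain u v where uv: "u \<in> ?S" "v \<in> ?S" "u \<noteq> v" "unlinked B {u, v}"
    using closure_three_stars_unlinked_pair[OF B(1) _ stars] by blast
  have uvV: "u \<in> V" "v \<in> V" using uv common_nbr_closure_subset[OF B(4,2)] by auto
  obtain x y where xy: "x < 21" "y < 21" "x \<noteq> y" "(x, y) \<notin> B" "{x, y} \<inter> {u, v} = {}"
    "(u, x) \<notin> B" "(v, x) \<notin> B" "(u, y) \<notin> B" "(v, y) \<notin> B"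
    using two_free_leaves[OF B(1) stars] by metis
  have xyV: "x \<in> V" "y \<in> V" using xy B(4) by auto
  obtain w where w: "w \<notin> V" using ex_new_if_finite[OF infinite_UNIV_nat B(3)] by blast
  obtain p where p: "p \<notin> insert w V"
    using ex_new_if_finite[OF infinite_UNIV_nat, of "insert w V"] B(3) by blast
  obtain q where q: "q \<notin> insert p (insert w V)"
    using ex_new_if_finite[OF infinite_UNIV_nat, of "insert p (insert w V)"] B(3) by blast
  define B1 where "B1 = add_vertex B w {u, v}"
  define B2 where "B2 = add_vertex B1 p {w, x}"
  define C where "C = add_vertex B2 q {w, p}"
  define D where "D = add_vertex B2 q {w, p, y}"
  have fresh: "(a, b) \<notin> B" if "a \<notin> V \<or> b \<notin> V" for a b using that B(2) by blast
  have xy': "(y, x) \<notin> B" "(x, u) \<notin> B" "(x, v) \<notin> B" "(y, u) \<notin> B" "(y, v) \<notin> B"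
    using xy B'(1) by blast+
  have B1: "B1 \<in> C4_free_class"
    unfolding B1_def by (rule add_vertex_in_class) (use B(1) w uvV uv fresh in auto)
  have B2: "B2 \<in> C4_free_class"
    unfolding B2_def
  proof (rule add_vertex_in_class[OF B1])
    show "(p, b) \<notin> B1" for b using p uvV fresh by (auto simp: B1_def add_vertex_def)
    show "unlinked B1 {w, x}"
      using w xyV xy xy' fresh by (auto simp: unlinked_def B1_def add_vertex_def)
  qed (use p xyV in auto)
  have fresh2: "(q, b) \<notin> B2" for b
    using q uvV xyV fresh by (auto simp: B2_def B1_def add_vertex_def)
  \<comment> \<open>In \<open>B2\<close> the neighbours of \<open>w\<close> are \<open>u\<close>,
    \<open>v\<close>, \<open>p\<close> and those of \<open>p\<close> are \<open>w\<close>,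
    \<open>x\<close>. These sets are disjoint, and \<open>y\<close> is adjacent to no member of
    either.\<close>
  have unl: "unlinked B2 {w, p, y}"
    using w p xyV uvV xy xy' fresh by (auto simp: unlinked_def B2_def B1_def add_vertex_def)
  then have "unlinked B2 {w, p}" by (auto simp: unlinked_def)
  then have C: "C \<in> C4_free_class"
    unfolding C_def by (intro add_vertex_in_class B2 fresh2) (use q in auto)
  have D: "D \<in> C4_free_class"
    unfolding D_def by (intro add_vertex_in_class B2 fresh2 unl) (use q xyV in auto)
  have "B \<subseteq> C" by (auto simp: C_def B2_def B1_def add_vertex_def)
  then have uvC: "u \<in> common_nbr_closure C {..<21}" "v \<in> common_nbr_closure C {..<21}"
    using uv common_nbr_closure_mono by metis+
  have wC: "w \<in> common_nbr_closure C {..<21}"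
    using uvC uv(3)
    by (rule common_nbr_closure.step) (auto simp: C_def B2_def B1_def add_vertex_def)
  have xC: "x \<in> common_nbr_closure C {..<21}"
    using xy by (auto intro: common_nbr_closure.base)
  have pC: "p \<in> common_nbr_closure C {..<21}"
    using wC xC by (rule common_nbr_closure.step)
      (use w xyV in \<open>auto simp: C_def B2_def B1_def add_vertex_def\<close>)
  have qC: "q \<in> common_nbr_closure C {..<21}"
    using wC pC by (rule common_nbr_closure.step)
      (use p in \<open>auto simp: C_def B2_def B1_def add_vertex_def\<close>)
  define W where "W = insert q (insert p (insert w V))"
  have W: "finite W" "V \<subseteq> W" "p \<in> W" "q \<in> W" "w \<in> W" using B(3) by (auto simp: W_def)
  have "B \<subseteq> W \<times> W" using B(2) W(2) by (meson Sigma_mono order_trans)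
  moreover have "{u, v, x, y} \<subseteq> W" using uvV xyV W(2) by blast
  ultimately have DW: "D \<subseteq> W \<times> W"
    using W(3-5) by (simp add: D_def B2_def B1_def add_vertex_def)
  have restrict: "add_vertex F t R \<inter> V \<times> V = F \<inter> V \<times> V" if "t \<notin> V" for F t R
    using that by (auto simp: add_vertex_def)
  have "B \<inter> V \<times> V = B" using B(2) by blast
  then have CD: "restrict_graph C V = B" "restrict_graph D V = B"
    using w p q by (simp_all add: C_def D_def B2_def B1_def restrict_graph_def restrict)
  have "C \<subseteq> D" by (auto simp: C_def D_def add_vertex_def)
  moreover have "(q, y) \<in> D" by (simp add: D_def add_vertex_def)
  moreover have "(q, y) \<notin> C" using w p q xyV fresh2 by (auto simp: C_def add_vertex_def)
  ultimately show ?thesis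
    using that[OF C D _ W(1,2) DW CD qC xy(2)] by blast
qed

section \<open>Baire category\<close>

text \<open>Nowhere density in terms of finite restrictions: the sets
  \<open>basic_open V (restrict_graph N V)\<close> are exactly the nonempty basic open sets.\<close>

definition avoidable :: "(nat \<times> nat) set set \<Rightarrow> bool" where
  "avoidable T \<longleftrightarrow> (\<forall>N\<in>C4_free_class. \<forall>V. finite V \<longrightarrow>
     (\<exists>N'\<in>basic_open V (restrict_graph N V). \<exists>W. finite W \<and>
        basic_open W (restrict_graph N' W) \<inter> T = {}))"

lemma mem_basic_open_restrict:
  "M \<in> basic_open V (restrict_graph N V) \<longleftrightarrow>
    M \<in> C4_free_class \<and> (\<forall>x\<in>V. \<forall>y\<in>V. (x, y) \<in> M \<longleftrightarrow> (x, y) \<in> N)"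
  unfolding basic_open_def restrict_graph_def by blast

lemma nowhere_dense_imp_avoidable:
  assumes "nowhere_dense_in C4_free_topology T"
  shows "avoidable T"
  unfolding avoidable_def
proof (intro ballI allI impI)
  fix N and V :: "nat set" assume N: "N \<in> C4_free_class" and V: "finite V"
  let ?X = C4_free_topology
  let ?U = "basic_open V (restrict_graph N V)"
  have U: "openin ?X ?U" by (rule openin_basic_open[OF N V])
  have "N \<in> ?U" using N by (simp add: mem_basic_open_restrict)
  then have "\<not> ?U \<subseteq> ?X closure_of T"
    using interior_of_maximal[OF _ U] assms unfolding nowhere_dense_in_def by blast
  then obtain M where M: "M \<in> ?U - ?X closure_of T" by blast
  have "openin ?X (?U - ?X closure_of T)"
    using U by (simp add: openin_diff)
  then obtain W where W: "finite W" "basic_open W (restrict_graph M W) \<subseteq> ?U - ?X closure_of T"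
    using M unfolding openin_C4_free_topology by blast
  have "T \<subseteq> ?X closure_of T"
    using assms closure_of_subset unfolding nowhere_dense_in_def by blast
  then show "\<exists>N'\<in>?U. \<exists>W. finite W \<and> basic_open W (restrict_graph N' W) \<inter> T = {}"
    using M W by blast
qed

text \<open>Finite conditions are extended step by step, stage \<open>n\<close> avoiding
  \<open>T n\<close> and deciding vertex \<open>n\<close>. The limit stays in the class because a
  violation would involve at most four vertices.\<close>

lemma Baire_C4_free_class:
  assumes "countable \<F>" and \<F>: "\<And>T. T \<in> \<F> \<Longrightarrow> avoidable T"
    and N0: "N0 \<in> C4_free_class" and V0: "finite V0"
  shows "\<exists>N\<in>basic_open V0 (restrict_graph N0 V0). N \<notin> \<Union>\<F>"
proof (cases "\<F> = {}")
  case True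
  then show ?thesis using N0 by (auto simp: mem_basic_open_restrict)
next
  case False
  define T where "T = from_nat_into \<F>"
  have T: "avoidable (T n)" "range T = \<F>" for n
    using False \<F> \<open>countable \<F>\<close> by (auto simp: T_def from_nat_into range_from_nat_into)
  \<comment> \<open>A state pairs a graph with the finite vertex set on which it is already final;
    the clause for \<open>n = 0\<close> fixes the start of the chain.\<close>
  define P where "P n x \<longleftrightarrow> (fst x \<in> C4_free_class \<and> finite (snd x)) \<and> (n = 0 \<longrightarrow> x = (N0, V0))"
    for n :: nat and x
  define Q where "Q n x y \<longleftrightarrow> snd x \<subseteq> snd y \<and> n \<in> snd y \<and>
       fst y \<in> basic_open (snd x) (restrict_graph (fst x) (snd x)) \<and>
       basic_open (snd y) (restrict_graph (fst y) (snd y)) \<inter> T n = {}" for n x y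
  have "\<exists>s. \<forall>n. P n (s n) \<and> Q n (s n) (s (Suc n))"
  proof (rule dependent_nat_choice)
    show "\<exists>x. P 0 x" using N0 V0 by (auto simp: P_def)
    fix x n assume "P n x"
    then have x: "fst x \<in> C4_free_class" "finite (snd x)" by (simp_all add: P_def)
    then obtain N' W where N': "N' \<in> basic_open (snd x) (restrict_graph (fst x) (snd x))"
      and W: "finite W" "basic_open W (restrict_graph N' W) \<inter> T n = {}"
      using T(1)[of n] unfolding avoidable_def by blast
    have sub: "basic_open (insert n (snd x \<union> W)) (restrict_graph N' (insert n (snd x \<union> W)))
        \<subseteq> basic_open W (restrict_graph N' W)"
      by (auto simp: mem_basic_open_restrict)
    show "\<exists>y. P (Suc n) y \<and> Q n x y"
      by (rule exI[of _ "(N', insert n (snd x \<union> W))"])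
        (use x N' W sub in \<open>auto simp: P_def Q_def mem_basic_open_restrict\<close>)
  qed
  then obtain s where "\<And>n. P n (s n)" "\<And>n. Q n (s n) (s (Suc n))" by blast
  then have s: "\<And>n. fst (s n) \<in> C4_free_class" "s 0 = (N0, V0)"
    "\<And>n. snd (s n) \<subseteq> snd (s (Suc n))" "\<And>n. n \<in> snd (s (Suc n))"
    "\<And>n. fst (s (Suc n)) \<in> basic_open (snd (s n)) (restrict_graph (fst (s n)) (snd (s n)))"
    "\<And>n. basic_open (snd (s (Suc n))) (restrict_graph (fst (s (Suc n))) (snd (s (Suc n)))) \<inter> T n = {}"
    unfolding P_def Q_def by blast+
  define N where "N = (\<lambda>n. fst (s n))"
  define V where "V = (\<lambda>n. snd (s n))"
  have V_mono: "V m \<subseteq> V n" if "m \<le> n" for m n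
    using s(3) lift_Suc_mono_le[of V] that by (simp add: V_def)
  have stable: "(x, y) \<in> N n \<longleftrightarrow> (x, y) \<in> N m" if "m \<le> n" "x \<in> V m" "y \<in> V m" for m n x y
    using that(1)
  proof (induction n rule: dec_induct)
    case (step n)
    have "x \<in> V n" "y \<in> V n" using that V_mono[OF step(1)] by auto
    then have "(x, y) \<in> N (Suc n) \<longleftrightarrow> (x, y) \<in> N n"
      using s(5)[of n] by (auto simp: mem_basic_open_restrict N_def V_def)
    then show ?case using step by simp
  qed simp
  define L where "L = (\<Union>n. restrict_graph (N n) (V n))"
  have L: "(x, y) \<in> L \<longleftrightarrow> (x, y) \<in> N n" if xy: "x \<in> V n" "y \<in> V n" for x y n
  proof
    assume "(x, y) \<in> L"
    then obtain m where "(x, y) \<in> N m" "x \<in> V m" "y \<in> V m"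
      by (auto simp: L_def restrict_graph_def)
    then show "(x, y) \<in> N n"
      using stable[of m n x y] stable[of n m x y] xy by (cases "m \<le> n") auto
  qed (use xy in \<open>auto simp: L_def restrict_graph_def\<close>)
  have inV: "x \<in> V n" if "x < n" for x n
    using s(4)[of x] V_mono[of "Suc x" n] that by (auto simp: V_def)
  have "N n \<in> C4_free_class" for n using s(1) by (simp add: N_def)
  note N' = C4_free_classD[OF this]
  have "L \<in> C4_free_class"
    unfolding C4_free_class_iff
  proof (intro conjI allI impI)
    show "sym L" using N'(1) by (fastforce simp: L_def sym_def restrict_graph_def)
    show "irrefl L" using N'(2) by (auto simp: L_def irrefl_def restrict_graph_def)
    fix a b x y assume e: "(a, x) \<in> L" "(b, x) \<in> L" "(a, y) \<in> L" "(b, y) \<in> L"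
    \<comment> \<open>By this stage all four vertices are decided, so \<open>L\<close> agrees with
      \<open>N n\<close> on them.\<close>
    define n where "n = Suc (a + b + x + y)"
    have "a \<in> V n" "b \<in> V n" "x \<in> V n" "y \<in> V n" by (auto intro!: inV simp: n_def)
    then show "a = b \<or> x = y" using e L[of _ n] N'(3)[of a x n b y] by blast
  qed
  then have mem: "L \<in> basic_open (V n) (restrict_graph (N n) (V n))" for n
    using L by (simp add: mem_basic_open_restrict)
  have "L \<notin> T n" for n using mem[of "Suc n"] s(6)[of n] by (auto simp: N_def V_def)
  moreover have "L \<in> basic_open V0 (restrict_graph N0 V0)"
    using mem[of 0] s(2) by (simp add: N_def V_def)
  ultimately show ?thesis using T(2) by blast
qed

section \<open>The isomorphism class near the stars as a countable union\<close>

definition embedded_stars :: "(nat \<times> nat) set \<Rightarrow> nat list \<Rightarrow> (nat \<times> nat) set set" where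
  "embedded_stars G g = {N \<in> C4_free_class. restrict_graph N {..<21} = three_stars \<and>
     (\<exists>f. inj f \<and> (\<forall>x y. (x, y) \<in> N \<longleftrightarrow> (f x, f y) \<in> G) \<and> map f [0..<21] = g)}"

text \<open>Of the open sets given by the two incompatible extensions, at least one misses
  \<open>embedded_stars G g\<close>: maps with the values \<open>g\<close> on the stars agree at
  \<open>q\<close> and \<open>y\<close>, so they cannot disagree about the edge between
  these.\<close>

lemma avoidable_embedded_stars:
  assumes G: "G \<in> C4_free_class"
  shows "avoidable (embedded_stars G g)"
  unfolding avoidable_def
proof (intro ballI allI impI)
  fix N and V :: "nat set" assume N: "N \<in> C4_free_class" and V: "finite V"
  let ?U = "basic_open V (restrict_graph N V)"
  let ?goal = "\<exists>N'\<in>?U. \<exists>W. finite W \<and> basic_open W (restrict_graph N' W) \<inter> embedded_stars G g = {}"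
  show ?goal
  proof (cases "?U \<inter> embedded_stars G g = {}")
    case True
    moreover have "N \<in> ?U" using N by (simp add: mem_basic_open_restrict)
    ultimately show ?thesis using V by blast
  next
    case False
    \<comment> \<open>The graph \<open>N\<close> itself need not contain the stars; \<open>M\<close>
      has the same restriction to \<open>V\<close> and does.\<close>
    then obtain M where M: "M \<in> ?U" "restrict_graph M {..<21} = three_stars"
      by (auto simp: embedded_stars_def)
    define V' where "V' = V \<union> {..<21}"
    define B where "B = restrict_graph M V'"
    have "M \<in> C4_free_class" using M by (simp add: mem_basic_open_restrict)
    then have "B \<in> C4_free_class" unfolding B_def by (rule restrict_graph_in_class)
    moreover have "B \<subseteq> V' \<times> V'" by (auto simp: B_def restrict_graph_def)
    moreover have "finite V'" "{..<21} \<subseteq> V'" using V by (auto simp: V'_def)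
    moreover have "restrict_graph B {..<21} = three_stars"
      unfolding M(2)[symmetric] by (auto simp: B_def V'_def restrict_graph_def)
    ultimately obtain C D W q y where CD: "C \<in> C4_free_class" "D \<in> C4_free_class" "C \<subseteq> D"
      and W: "finite W" "V' \<subseteq> W" "D \<subseteq> W \<times> W"
      and CB: "restrict_graph C V' = B" and DB: "restrict_graph D V' = B"
      and q: "q \<in> common_nbr_closure C {..<21}" "y < 21" "(q, y) \<in> D" "(q, y) \<notin> C"
      by (rule incompatible_extensions)
    have "C \<in> ?U" "D \<in> ?U"
    proof -
      have "(x, y) \<in> C \<longleftrightarrow> (x, y) \<in> M" "(x, y) \<in> D \<longleftrightarrow> (x, y) \<in> M" if "x \<in> V" "y \<in> V" for x y
        using CB DB that by (auto simp: B_def V'_def restrict_graph_def set_eq_iff)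
      then show "C \<in> ?U" "D \<in> ?U"
        using CD(1,2) M(1) by (simp_all add: mem_basic_open_restrict)
    qed
    moreover have False
      if N1: "N1 \<in> basic_open W (restrict_graph C W)" "N1 \<in> embedded_stars G g"
        and N2: "N2 \<in> basic_open W (restrict_graph D W)" "N2 \<in> embedded_stars G g" for N1 N2
    proof -
      have C1: "C \<subseteq> N1" and D2: "D \<subseteq> N2"
        using N1(1) N2(1) W(3) CD(3) unfolding mem_basic_open_restrict by blast+
      obtain f1 where f1: "inj f1" "\<And>x y. (x, y) \<in> N1 \<longleftrightarrow> (f1 x, f1 y) \<in> G" "map f1 [0..<21] = g"
        using N1(2) unfolding embedded_stars_def by blast
      obtain f2 where f2: "inj f2" "\<And>x y. (x, y) \<in> N2 \<longleftrightarrow> (f2 x, f2 y) \<in> G" "map f2 [0..<21] = g"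
        using N2(2) unfolding embedded_stars_def by blast
      have "map f1 [0..<21] = map f2 [0..<21]" using f1(3) f2(3) by simp
      then have eq: "f1 a = f2 a" if "a \<in> {..<21}" for a
        using that unfolding map_eq_conv by auto
      \<comment> \<open>Both \<open>N1\<close> and \<open>N2\<close> contain \<open>C\<close>, the
        latter through \<open>D\<close>, so both maps preserve the edges of
        \<open>C\<close>.\<close>
      have "f1 q = f2 q"
        using G f1(1) _ _ eq q(1)
        by (rule embeddings_agree_on_closure) (use C1 D2 CD(3) f1(2) f2(2) in blast)+
      moreover have "(f2 q, f2 y) \<in> G" using q(3) D2 f2(2) by blast
      ultimately have "(q, y) \<in> N1" using f1(2) eq[of y] q(2) by simp
      moreover have "q \<in> W" "y \<in> W" using q(3) W(3) by auto
      ultimately show False using N1(1) q(4) unfolding mem_basic_open_restrict by blast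
    qed
    ultimately show ?thesis using W(1) by blast
  qed
qed

theorem theorem2:
  shows "\<not> (\<exists>G. generic G)"
proof
  assume "\<exists>G. generic G"
  then obtain G where G: "G \<in> C4_free_class"
    and "comeager_in C4_free_topology {N \<in> C4_free_class. graph_isomorphic UNIV N UNIV G}"
    (is "comeager_in _ ?I") unfolding generic_def by blast
  then obtain \<F> where \<F>: "countable \<F>" "\<And>T. T \<in> \<F> \<Longrightarrow> nowhere_dense_in C4_free_topology T"
    "C4_free_class - ?I = \<Union>\<F>"
    unfolding comeager_in_def meager_in_def topspace_C4_free_topology by metis
  \<comment> \<open>There are only countably many lists \<open>g\<close>, so one graph avoids both
    the complement of the isomorphism class and every \<open>embedded_stars G g\<close>. It is then
    isomorphic to \<open>G\<close>, and the values of an isomorphism on the stars give a forbidden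
    \<open>g\<close>.\<close>
  have "\<exists>N\<in>basic_open {..<21} (restrict_graph three_stars {..<21}).
      N \<notin> \<Union>(\<F> \<union> range (embedded_stars G))"
    by (rule Baire_C4_free_class)
      (use \<F> G three_stars_in_class in
        \<open>auto intro: nowhere_dense_imp_avoidable avoidable_embedded_stars\<close>)
  then obtain N where N: "N \<in> C4_free_class" "restrict_graph N {..<21} = three_stars"
    "N \<notin> \<Union>\<F>" "\<And>g. N \<notin> embedded_stars G g"
    by (auto simp: basic_open_def restrict_three_stars)
  then have "graph_isomorphic UNIV N UNIV G" using \<F>(3) by blast
  then obtain f where "bij f" "\<forall>x y. (x, y) \<in> N \<longleftrightarrow> (f x, f y) \<in> G"
    unfolding graph_isomorphic_def by auto
  then have "N \<in> embedded_stars G (map f [0..<21])"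
    using N(1,2) bij_is_inj unfolding embedded_stars_def by blast
  then show False using N(4) by blast
qed

end
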